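(* For every positive integer $n$, $$A_n(x)=\sum_{T\in \operatorname{SYT}(n)}\left(\prod_{i=1}^n \sigma_i(T)\right)x^{\ell(\lambda(T))}.$$
   Context: $A_n(x)=\sum_{\pi\in\mathfrak{S}_n}x^{{\rm des}(\pi)}$, where for $\pi=\pi_1\cdots\pi_n$ with $\pi_{n+1}=0$, ${\rm des}(\pi)=\#\{i\in[n]:\pi_i>\pi_{i+1}\}$ (so $A_1(x)=x$). $\operatorname{SYT}(n)$ is the set of standard Young tableaux with $n$ boxes (French convention: rows of weakly decreasing lengths from bottom to top, entries increasing along rows and up columns). $\ell(\lambda(T))$ is the number of rows of $T$. For $1\leqslant i\leqslant n$, $T_i$ is obtained from $T$ by deleting entries $i+1,\ldots,n$, and $\operatorname{col}_k(T_i)$ is the size of the $k$-th column of $T_i$; $\sigma_i(T)=i-\operatorname{col}_1(T_i)+1$ if $i$ lies in the first column of $T$, and $\sigma_i(T)=\operatorname{col}_k(T_i)-\operatorname{col}_{k+1}(T_i)+1$ if $i$ lies in the $(k+1)$-th column, $k\geqslant1$. *)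

theory Defs
  imports "HOL-Combinatorics.Permutations" "HOL-Computational_Algebra.Polynomial"
begin

(* The update at n + 1 is the convention that the word of p is followed by an entry 0,
   so position n always is a descent. *)
definition des :: "nat \<Rightarrow> (nat \<Rightarrow> nat) \<Rightarrow> nat" where
  "des n p = (let w = p(n + 1 := 0) in card {i \<in> {1..n}. w i > w (i + 1)})"

definition eulerian_poly :: "nat \<Rightarrow> int poly" where
  "eulerian_poly n = (\<Sum>p | p permutes {1..n}. monom 1 (des n p))"

(* A filling of a Young diagram is the list of its rows, from the bottom row to the top row
   (French convention), each row being read from left to right. *)
type_synonym tableau = "nat list list"

definition shape :: "tableau \<Rightarrow> nat list" where
  "shape T = map length T"

(* Columns are numbered from 1 and listed from bottom to top; column T 0 has no meaning. *)
definition column :: "tableau \<Rightarrow> nat \<Rightarrow> nat list" where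
  "column T k = map (\<lambda>R. R ! (k - 1)) (filter (\<lambda>R. k \<le> length R) T)"

definition col :: "nat \<Rightarrow> tableau \<Rightarrow> nat" where
  "col k T = length (column T k)"

definition SYT :: "nat \<Rightarrow> tableau set" where
  "SYT n = {T.
     sorted_wrt (\<ge>) (shape T) \<and> (\<forall>R \<in> set T. R \<noteq> []) \<and>
     distinct (concat T) \<and> set (concat T) = {1..n} \<and>
     (\<forall>R \<in> set T. sorted_wrt (<) R) \<and>
     (\<forall>k \<ge> 1. sorted_wrt (<) (column T k))}"

(* T_i: the entries greater than i are deleted, and so are the rows that become empty. *)
definition subtableau :: "tableau \<Rightarrow> nat \<Rightarrow> tableau" where
  "subtableau T i = filter (\<lambda>R. R \<noteq> []) (map (filter (\<lambda>e. e \<le> i)) T)"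

(* Integer-valued, to avoid truncated subtraction. *)
definition sigma :: "nat \<Rightarrow> tableau \<Rightarrow> int" where
  "sigma i T =
     (if i \<in> set (column T 1) then int i - int (col 1 (subtableau T i)) + 1
      else (let k = (THE k. k \<ge> 1 \<and> i \<in> set (column T (k + 1)))
            in int (col k (subtableau T i)) - int (col (k + 1) (subtableau T i)) + 1))"

lemma finite_SYT: "finite (SYT n)"
proof -
  let ?F = "{R. set R \<subseteq> {1..n} \<and> length R \<le> n}"
  have "length T \<le> n \<and> set T \<subseteq> ?F" if "T \<in> SYT n" for T
  proof -
    from that have ne: "\<forall>R \<in> set T. R \<noteq> []" and d: "distinct (concat T)"
      and s: "set (concat T) = {1..n}"
      by (auto simp: SYT_def)
    have len: "length (concat T) = n"
      using distinct_card[OF d] s by simp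
    have "length T \<le> length (concat T)"
      using ne
    proof (induction T)
      case (Cons R T)
      then have "length R \<ge> 1" by (simp add: Suc_le_eq)
      with Cons show ?case by simp
    qed simp
    moreover have "length R \<le> length (concat T)" if "R \<in> set T" for R
      using that by (simp add: length_concat member_le_sum_list)
    ultimately show ?thesis using len s by fastforce
  qed
  then have "SYT n \<subseteq> {T. set T \<subseteq> ?F \<and> length T \<le> n}" by blast
  moreover have "finite ?F"
    by (rule finite_lists_length_le) simp
  then have "finite {T. set T \<subseteq> ?F \<and> length T \<le> n}"
    by (rule finite_lists_length_le)
  ultimately show ?thesis
    by (rule finite_subset)
qed

end

theory Submission
  imports Defs
begin

text \<open>
  Both sides satisfy the recurrence \<open>P\<^sub>n\<^sub>+\<^sub>1 = L\<^sub>n P\<^sub>n\<close>, where \<open>L\<^sub>n\<close> is the linear operator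
  sending \<open>x\<^sup>k\<close> to \<open>k x\<^sup>k + (n + 1 - k) x\<^sup>k\<^sup>+\<^sup>1\<close>. For permutations, inserting \<open>n + 1\<close> at one of
  the \<open>k\<close> descents keeps the number of descents, while at any other place it creates one. For
  tableaux with \<open>k\<close> rows, putting \<open>n + 1\<close> into a new row has weight \<open>n + 1 - k\<close>; appending it to
  the first row of length \<open>r\<close> has weight \<open>col r - col (r + 1)\<close>, the number of rows of length \<open>r\<close>,
  and these weights sum up to \<open>k\<close>.
\<close>

section \<open>The recurrence operator\<close>

text \<open>The differential form of the classical Eulerian recurrence. Linearity is immediate from
  it; the action on monomials follows in \<open>eulerian_step_monom\<close>.\<close>

definition eulerian_step :: "nat \<Rightarrow> int poly \<Rightarrow> int poly" where
  "eulerian_step n P = smult (int n + 1) (monom 1 1 * P) + (monom 1 1 - monom 1 2) * pderiv P"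

lemma eulerian_step_sum: "eulerian_step n (\<Sum>a\<in>A. f a) = (\<Sum>a\<in>A. eulerian_step n (f a))"
  by (induction A rule: infinite_finite_induct)
    (auto simp: eulerian_step_def pderiv_add smult_add_right algebra_simps)

lemma eulerian_step_monom:
  "eulerian_step n (monom c k) = monom (c * int k) k + monom (c * (int n + 1 - int k)) (k + 1)"
\<comment> \<open>The derivative has the truncated exponent \<open>k - 1\<close>, so
  \<open>k = 0\<close>, where it vanishes, is treated apart.\<close>
proof (cases k)
  case 0
  then show ?thesis
    by (simp add: eulerian_step_def pderiv_monom mult_monom smult_monom)
next
  case (Suc m)
  then show ?thesis
    by (intro poly_eqI)
      (auto simp: eulerian_step_def pderiv_monom mult_monom smult_monom algebra_simps)
qed

section \<open>Inserting the largest letter into a permutation\<close>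

text \<open>A permutation \<open>p\<close> of \<open>{1..n}\<close> fixes \<open>n + 1\<close>.
  Precomposing with this cycle moves that letter to position \<open>i + 1\<close> and shifts the
  letters after it by one, so \<open>i\<close> letters precede it.\<close>

definition insert_cycle :: "nat \<Rightarrow> nat \<Rightarrow> nat \<Rightarrow> nat" where
  "insert_cycle n i k =
    (if k \<le> i then k else if k = Suc i then Suc n else if k \<le> Suc n then k - 1 else k)"

lemma insert_cycle_permutes:
  assumes "i \<le> n"
  shows "insert_cycle n i permutes {1..Suc n}"
proof (rule bij_imp_permutes)
  let ?g = "\<lambda>k. if k \<le> i then k else if k = Suc n then Suc i else if k \<le> n then Suc k else k"
  show "bij_betw (insert_cycle n i) {1..Suc n} {1..Suc n}"
    by (rule bij_betw_byWitness[where f' = ?g]) (use assms in \<open>auto simp: insert_cycle_def\<close>)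
qed (use assms in \<open>auto simp: insert_cycle_def\<close>)

lemma insert_cycle_eq_Suc_n:
  assumes "i \<le> n"
  shows "insert_cycle n i k = Suc n \<longleftrightarrow> k = Suc i"
  using assms by (auto simp: insert_cycle_def)

text \<open>The position of the letter \<open>n + 1\<close> gives back \<open>i\<close>, and then
  the cycle can be cancelled. Conversely, undoing the cycle moves \<open>n + 1\<close> to the end of
  the word and leaves a permutation of \<open>{1..n}\<close>.\<close>

lemma bij_betw_insert_letter:
  "bij_betw (\<lambda>(p, i). p \<circ> insert_cycle n i)
     ({p. p permutes {1..n}} \<times> {0..n}) {q. q permutes {1..Suc n}}"
proof (rule bij_betw_imageI)
  show "inj_on (\<lambda>(p, i). p \<circ> insert_cycle n i) ({p. p permutes {1..n}} \<times> {0..n})"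
  proof (rule inj_onI, clarsimp)
    fix p i q j
    assume p: "p permutes {Suc 0..n}" and q: "q permutes {Suc 0..n}" and i: "i \<le> n" and j: "j \<le> n"
      and eq: "p \<circ> insert_cycle n i = q \<circ> insert_cycle n j"
    have "q (insert_cycle n j (Suc i)) = p (insert_cycle n i (Suc i))"
      using fun_cong[OF eq, of "Suc i"] by simp
    also have "\<dots> = Suc n"
      using permutes_not_in[OF p] by (simp add: insert_cycle_def)
    also have "\<dots> = q (Suc n)"
      using permutes_not_in[OF q] by simp
    finally have "insert_cycle n j (Suc i) = Suc n"
      using permutes_inj[OF q] by (auto dest: injD)
    then have ij: "i = j"
      using insert_cycle_eq_Suc_n[OF j] by simp
    have "p = p \<circ> (insert_cycle n i \<circ> inv (insert_cycle n i))"
      using permutes_inv_o(1)[OF insert_cycle_permutes[OF i]] by simp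
    also have "\<dots> = q \<circ> (insert_cycle n i \<circ> inv (insert_cycle n i))"
      using eq ij by (simp flip: comp_assoc)
    also have "\<dots> = q"
      using permutes_inv_o(1)[OF insert_cycle_permutes[OF i]] by simp
    finally show "p = q \<and> i = j" using ij by simp
  qed
  show "(\<lambda>(p, i). p \<circ> insert_cycle n i) ` ({p. p permutes {1..n}} \<times> {0..n}) =
    {q. q permutes {1..Suc n}}" (is "?f ` ?A = ?B")
  proof
    show "?f ` ?A \<subseteq> ?B"
    proof clarsimp
      fix p i
      assume p: "p permutes {Suc 0..n}" and i: "i \<le> n"
      have "p permutes {1..Suc n}"
        by (rule permutes_subset[OF p]) auto
      then show "p \<circ> insert_cycle n i permutes {Suc 0..Suc n}"
        using permutes_compose[OF insert_cycle_permutes[OF i]] by simp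
    qed
    show "?B \<subseteq> ?f ` ?A"
    proof
      fix q assume "q \<in> ?B"
      then have q: "q permutes {1..Suc n}" by simp
      have "Suc n \<in> q ` {1..Suc n}"
        unfolding permutes_image[OF q] by simp
      then obtain j where j: "j \<in> {1..Suc n}" "q j = Suc n"
        by auto
      define i where "i = j - 1"
      have i: "i \<le> n" "q (Suc i) = Suc n"
        using j by (auto simp: i_def)
      let ?c = "insert_cycle n i"
      have c: "?c permutes {1..Suc n}"
        by (rule insert_cycle_permutes[OF i(1)])
      define p where "p = q \<circ> inv ?c"
      have pS: "p permutes {1..Suc n}"
        unfolding p_def by (rule permutes_compose[OF permutes_inv[OF c] q])
      have "inv ?c (Suc n) = Suc i"
        using permutes_inverses(2)[OF c, of "Suc i"] by (simp add: insert_cycle_def)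
      then have "p (Suc n) = Suc n"
        by (simp add: p_def i)
      with pS have "p permutes {1..n}"
        using permutes_superset[OF pS, of "{1..n}"] by (auto simp: le_Suc_eq)
      moreover have "q = p \<circ> ?c"
        using permutes_inv_o(2)[OF c] by (simp add: p_def comp_assoc)
      ultimately show "q \<in> ?f ` ?A"
        using i(1) by force
    qed
  qed
qed

section \<open>Descents after an insertion\<close>

text \<open>Positions are kept, not only their number, because the effect of an insertion depends on
  whether its place is a descent.\<close>

definition descents :: "nat \<Rightarrow> (nat \<Rightarrow> nat) \<Rightarrow> nat set" where
  "descents n p = {i \<in> {1..n}. (p(Suc n := 0)) i > (p(Suc n := 0)) (Suc i)}"

lemma des_eq_card_descents: "des n p = card (descents n p)"
  by (simp add: des_def descents_def Let_def)

lemma descents_subset: "descents n p \<subseteq> {1..n}"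
  by (auto simp: descents_def)

lemma finite_descents [simp]: "finite (descents n p)"
  using descents_subset by (rule finite_subset) simp

text \<open>The new letter exceeds all others and the closing 0, so its position is a descent and
  the position before it is not. Comparisons to its left are unchanged, those to its right move by
  one, and the one between positions \<open>i\<close> and \<open>i + 1\<close> of \<open>p\<close>
  is lost.\<close>

lemma descents_insert_letter:
  assumes p: "p permutes {1..n}" and i: "i \<le> n"
  shows "descents (Suc n) (p \<circ> insert_cycle n i) =
    insert (Suc i) ({k \<in> descents n p. k < i} \<union> Suc ` {k \<in> descents n p. i < k})"
proof -
  let ?w = "p(Suc n := 0)" and ?v = "(p \<circ> insert_cycle n i)(Suc (Suc n) := 0)"
  have pS: "p (Suc n) = Suc n"
    using permutes_not_in[OF p] by simp
  \<comment> \<open>Positions 0 and \<open>Suc n\<close> both carry the value 0, so the bound covers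
    them as well.\<close>
  have w_le: "?w k \<le> n" if "k \<le> Suc n" for k
    using that permutes_in_image[OF p, of k] permutes_not_in[OF p, of 0]
    by (cases "k = 0") auto
  have v1: "?v k = ?w k" if "k \<le> i" for k
    using that i by (auto simp: insert_cycle_def)
  have v2: "?v (Suc i) = Suc n"
    using i pS by (auto simp: insert_cycle_def)
  \<comment> \<open>For \<open>k = Suc n\<close> this matches the closing 0 of both words.\<close>
  have v3: "?v (Suc k) = ?w k" if "i < k" "k \<le> Suc n" for k
    using that by (auto simp: insert_cycle_def)
  have "k \<in> descents (Suc n) (p \<circ> insert_cycle n i) \<longleftrightarrow>
      k = Suc i \<or> k \<in> descents n p \<and> k < i \<or> (\<exists>l. k = Suc l \<and> l \<in> descents n p \<and> i < l)"
    (is "?L k \<longleftrightarrow> ?R k") for k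
  proof -
    have L: "?L k \<longleftrightarrow> k \<in> {1..Suc n} \<and> ?v k > ?v (Suc k)"
      by (simp add: descents_def)
    have D: "l \<in> descents n p \<longleftrightarrow> l \<in> {1..n} \<and> ?w l > ?w (Suc l)" for l
      by (simp add: descents_def)
    \<comment> \<open>The comparison at \<open>k\<close> lies left of the new letter, ends at it,
      starts at it, or lies right of it.\<close>
    consider "k < i" | "k = i" | "k = Suc i" | l where "k = Suc l" "i < l"
      by (metis linorder_neqE_nat Suc_lessI Suc_lessE less_Suc_eq)
    then show ?thesis
    proof cases
      case 1
      with v1[of k] v1[of "Suc k"] i show ?thesis
        unfolding L D by auto
    next
      case 2
      with v1[of k] v2 w_le[of k] i have "\<not> ?L k"
        unfolding L by simp
      moreover have "\<not> ?R k" using 2 by auto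
      ultimately show ?thesis by blast
    next
      case 3
      with v2 v3[of "Suc i"] w_le[of "Suc i"] i have "?L k"
        unfolding L by (cases "i = n") auto
      moreover have "?R k" using 3 by blast
      ultimately show ?thesis by blast
    next
      case 4
      have "?L k \<longleftrightarrow> l \<in> descents n p"
      proof (cases "l \<le> n")
        case True
        with 4 v3[of l] v3[of "Suc l"] show ?thesis unfolding L D by auto
      next
        case False
        with 4 show ?thesis unfolding L D by auto
      qed
      moreover have "?R k \<longleftrightarrow> l \<in> descents n p"
        using 4 by auto
      ultimately show ?thesis by blast
    qed
  qed
  then show ?thesis by blast
qed

text \<open>One descent is gained at \<open>Suc i\<close>, and one is lost exactly if
  \<open>i\<close> was a descent.\<close>

lemma des_insert_letter:
  assumes "p permutes {1..n}" and "i \<le> n"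
  shows "des (Suc n) (p \<circ> insert_cycle n i) = (if i \<in> descents n p then des n p else des n p + 1)"
proof -
  let ?D = "descents n p"
  let ?A = "{k \<in> ?D. k < i}" and ?B = "{k \<in> ?D. i < k}"
  \<comment> \<open>The first set lies below \<open>i\<close> and the shifted one above
    \<open>Suc i\<close>; they are disjoint and both miss \<open>Suc i\<close>.\<close>
  have "card (?A \<union> Suc ` ?B) = card ?A + card (Suc ` ?B)"
    by (rule card_Un_disjoint) auto
  then have "card (insert (Suc i) (?A \<union> Suc ` ?B)) = Suc (card ?A + card ?B)"
    by (subst card_insert_disjoint) (auto simp: card_image)
  moreover have "card ?D = card ?A + card ?B + (if i \<in> ?D then 1 else 0)"
  proof -
    have "card ?A + card ?B = card (?A \<union> ?B)"
      by (rule card_Un_disjoint[symmetric]) auto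
    also have "?A \<union> ?B = ?D - {i}"
      by auto
    finally show ?thesis
      using card_Suc_Diff1[of ?D i] by (cases "i \<in> ?D") simp_all
  qed
  ultimately show ?thesis
    using assms by (simp add: des_eq_card_descents descents_insert_letter)
qed

lemma sum_insert_letter:
  assumes p: "p permutes {1..n}"
  shows "(\<Sum>i = 0..n. monom (1::int) (des (Suc n) (p \<circ> insert_cycle n i))) =
    eulerian_step n (monom 1 (des n p))"
proof -
  let ?D = "descents n p" and ?d = "des n p"
  have D: "?D \<subseteq> {0..n}" using descents_subset by fastforce
  \<comment> \<open>The bound turns the truncated \<open>n + 1 - ?d\<close> into an integer
    difference below.\<close>
  then have le: "?d \<le> n + 1"
    using card_mono[OF _ D] by (simp add: des_eq_card_descents)
  have "(\<Sum>i = 0..n. monom (1::int) (des (Suc n) (p \<circ> insert_cycle n i))) =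
      (\<Sum>i = 0..n. monom 1 (if i \<in> ?D then ?d else ?d + 1))"
    using p by (intro sum.cong) (auto simp: des_insert_letter)
  also have "\<dots> = (\<Sum>i\<in>{0..n} - ?D. monom 1 (?d + 1)) + (\<Sum>i\<in>?D. monom 1 ?d)"
    by (subst sum.subset_diff[OF D]) simp_all
  also have "\<dots> = monom (int (n + 1 - ?d)) (?d + 1) + monom (int ?d) ?d"
    using D by (simp add: card_Diff_subset des_eq_card_descents of_nat_monom mult_monom)
  also have "\<dots> = eulerian_step n (monom 1 ?d)"
    using le by (simp add: eulerian_step_monom of_nat_diff)
  finally show ?thesis .
qed

lemma eulerian_poly_Suc: "eulerian_poly (Suc n) = eulerian_step n (eulerian_poly n)"
proof -
  have "eulerian_poly (Suc n) =
      (\<Sum>(p, i)\<in>{p. p permutes {1..n}} \<times> {0..n}. monom 1 (des (Suc n) (p \<circ> insert_cycle n i)))"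
    unfolding eulerian_poly_def
    by (subst sum.reindex_bij_betw[OF bij_betw_insert_letter, symmetric])
      (simp add: case_prod_unfold)
  also have "\<dots> = (\<Sum>p | p permutes {1..n}. eulerian_step n (monom 1 (des n p)))"
    by (subst sum.cartesian_product[symmetric]) (intro sum.cong refl, simp add: sum_insert_letter)
  finally show ?thesis
    by (simp add: eulerian_poly_def eulerian_step_sum)
qed

section \<open>Adding the largest entry to a standard Young tableau\<close>

text \<open>Merges the shape and column conditions for two rows, so that tableaux can be treated as
  lists of rows without reference to columns.\<close>

definition row_below :: "nat list \<Rightarrow> nat list \<Rightarrow> bool" where
  "row_below R S \<longleftrightarrow> length S \<le> length R \<and> (\<forall>k < length S. R ! k < S ! k)"

lemma sorted_column_Cons:
  "sorted_wrt (<) (column (R # T) k) \<longleftrightarrow> sorted_wrt (<) (column T k) \<and>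
    (k \<le> length R \<longrightarrow> (\<forall>S \<in> set T. k \<le> length S \<longrightarrow> R ! (k - 1) < S ! (k - 1)))"
  by (auto simp: column_def)

lemma sorted_wrt_row_below_iff:
  "sorted_wrt row_below T \<longleftrightarrow>
    sorted_wrt (\<ge>) (shape T) \<and> (\<forall>k \<ge> 1. sorted_wrt (<) (column T k))"
proof (induction T)
  case Nil
  show ?case by (simp add: shape_def column_def)
next
  case (Cons R T)
  have row: "(\<forall>S \<in> set T. row_below R S) \<longleftrightarrow> (\<forall>S \<in> set T. length S \<le> length R) \<and>
      (\<forall>k \<ge> 1. k \<le> length R \<longrightarrow> (\<forall>S \<in> set T. k \<le> length S \<longrightarrow> R ! (k - 1) < S ! (k - 1)))"
    (is "?L \<longleftrightarrow> ?R1 \<and> ?R2")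
  proof
    assume ?L
    then show "?R1 \<and> ?R2" by (auto simp: row_below_def)
  next
    assume R: "?R1 \<and> ?R2"
    \<comment> \<open>List index \<open>k\<close> belongs to column \<open>Suc k\<close>, as columns
      are numbered from 1.\<close>
    have "R ! k < S ! k" if "S \<in> set T" "k < length S" for S k
      using R[THEN conjunct2, rule_format, of "Suc k" S] R that by fastforce
    with R show ?L by (auto simp: row_below_def)
  qed
  have shape: "sorted_wrt (\<ge>) (shape (R # T)) \<longleftrightarrow> ?R1 \<and> sorted_wrt (\<ge>) (shape T)"
    by (simp add: shape_def)
  have columns: "(\<forall>k \<ge> 1. sorted_wrt (<) (column (R # T) k)) \<longleftrightarrow>
      (\<forall>k \<ge> 1. sorted_wrt (<) (column T k)) \<and> ?R2"
    unfolding sorted_column_Cons by blast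
  show ?case
    by (simp only: sorted_wrt.simps row shape columns Cons.IH conj_ac)
qed

lemma SYT_iff:
  "T \<in> SYT n \<longleftrightarrow> sorted_wrt row_below T \<and> [] \<notin> set T \<and> distinct (concat T) \<and>
    set (concat T) = {1..n} \<and> (\<forall>R \<in> set T. sorted_wrt (<) R)"
proof -
  have "(\<forall>R \<in> set T. R \<noteq> []) \<longleftrightarrow> [] \<notin> set T" by metis
  then show ?thesis
    by (simp only: SYT_def mem_Collect_eq sorted_wrt_row_below_iff conj_ac)
qed

lemma SYT_entry_le: "T \<in> SYT n \<Longrightarrow> R \<in> set T \<Longrightarrow> e \<in> set R \<Longrightarrow> e \<le> n"
  by (force simp: SYT_iff)

lemma SYT_0: "SYT 0 = {[]}"
proof -
  have "T = []" if "T \<in> SYT 0" for T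
    using that by (cases T) (auto simp: SYT_iff)
  moreover have "[] \<in> SYT 0" by (simp add: SYT_iff)
  ultimately show ?thesis by blast
qed

section \<open>Restricting a tableau to its small entries\<close>

text \<open>Only larger entries follow an entry above \<open>m\<close>. So the filter cuts off an
  end of the row, and the surviving entries keep their positions.\<close>

lemma sorted_filter_le_eq_take:
  fixes R :: "nat list"
  assumes "sorted_wrt (<) R"
  shows "filter (\<lambda>e. e \<le> m) R = take (length (filter (\<lambda>e. e \<le> m) R)) R"
  using assms
proof (induction R)
  case (Cons a R)
  show ?case
  proof (cases "a \<le> m")
    case True
    with Cons show ?thesis by auto
  next
    case False
    with Cons.prems have "filter (\<lambda>e. e \<le> m) R = []"
      by (force simp: filter_empty_conv)
    with False show ?thesis by simp
  qed
qed simp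

text \<open>A surviving entry of \<open>S\<close> lies above a smaller entry of \<open>R\<close>,
  which survives too. Hence the lengths stay ordered, and the remaining entries are compared at
  their old positions.\<close>

lemma row_below_filter_le:
  assumes "row_below R S" and R: "sorted_wrt (<) R" and S: "sorted_wrt (<) S"
  shows "row_below (filter (\<lambda>e. e \<le> m) R) (filter (\<lambda>e. e \<le> m) S)"
proof -
  let ?r = "length (filter (\<lambda>e. e \<le> m) R)" and ?s = "length (filter (\<lambda>e. e \<le> m) S)"
  have len: "length S \<le> length R" and lt: "\<And>k. k < length S \<Longrightarrow> R ! k < S ! k"
    using assms by (auto simp: row_below_def)
  have sS: "?s \<le> length S" by simp
  have nthS: "S ! k \<le> m" if "k < ?s" for k
  proof -
    have "filter (\<lambda>e. e \<le> m) S ! k \<le> m"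
      using nth_mem[OF that] by simp
    also have "filter (\<lambda>e. e \<le> m) S ! k = S ! k"
      using that by (subst sorted_filter_le_eq_take[OF S]) simp
    finally show ?thesis .
  qed
  have "?s \<le> ?r"
  proof -
    have "take ?s R = filter (\<lambda>e. e \<le> m) (take ?s R)"
    proof (rule filter_True[symmetric], rule ballI)
      fix e assume "e \<in> set (take ?s R)"
      then obtain k where "k < ?s" "k < length R" "e = R ! k"
        by (auto simp: in_set_conv_nth)
      with lt[of k] nthS[of k] sS show "e \<le> m" by linarith
    qed
    then have "?s = length (filter (\<lambda>e. e \<le> m) (take ?s R))"
      using len sS by (metis length_take min.absorb2 order_trans)
    also have "\<dots> \<le> ?r"
      by (metis append_take_drop_id filter_append length_append le_add1)
    finally show ?thesis .
  qed
  moreover have "filter (\<lambda>e. e \<le> m) R ! k < filter (\<lambda>e. e \<le> m) S ! k" if "k < ?s" for k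
    using that lt[of k] sS \<open>?s \<le> ?r\<close>
    by (subst (1 2) sorted_filter_le_eq_take) (use R S in auto)
  ultimately show ?thesis by (simp add: row_below_def)
qed

lemma concat_subtableau: "concat (subtableau T m) = filter (\<lambda>e. e \<le> m) (concat T)"
  by (induction T) (auto simp: subtableau_def)

lemma subtableau_in_SYT:
  assumes T: "T \<in> SYT n" and "m \<le> n"
  shows "subtableau T m \<in> SYT m"
proof -
  have below: "sorted_wrt row_below T" and rows: "\<And>R. R \<in> set T \<Longrightarrow> sorted_wrt (<) R"
    and dist: "distinct (concat T)" and entries: "set (concat T) = {1..n}"
    using T unfolding SYT_iff by blast+
  have "sorted_wrt (\<lambda>R S. row_below (filter (\<lambda>e. e \<le> m) R) (filter (\<lambda>e. e \<le> m) S)) T"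
    by (rule sorted_wrt_mono_rel[OF _ below]) (intro row_below_filter_le rows)
  then have "sorted_wrt row_below (subtableau T m)"
    unfolding subtableau_def by (intro sorted_wrt_filter) (simp add: sorted_wrt_map)
  moreover have "set (concat (subtableau T m)) = {1..m}"
    unfolding concat_subtableau set_filter entries using \<open>m \<le> n\<close> by auto
  moreover have "distinct (concat (subtableau T m))"
    unfolding concat_subtableau using dist by (rule distinct_filter)
  moreover have "\<forall>R \<in> set (subtableau T m). sorted_wrt (<) R"
    using rows by (auto simp: subtableau_def sorted_wrt_filter)
  moreover have "[] \<notin> set (subtableau T m)"
    by (simp add: subtableau_def)
  ultimately show ?thesis unfolding SYT_iff by blast
qed

lemma subtableau_subtableau:
  assumes "i \<le> m"
  shows "subtableau (subtableau T m) i = subtableau T i"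
proof -
  have "filter (\<lambda>e. e \<le> i) (filter (\<lambda>e. e \<le> m) R) = filter (\<lambda>e. e \<le> i) R" for R :: "nat list"
    using assms by (induction R) auto
  \<comment> \<open>A row dropped by the first restriction would also become empty in the
    second.\<close>
  moreover have "filter (\<lambda>e. e \<le> i) R = []" if "filter (\<lambda>e. e \<le> m) R = []" for R :: "nat list"
    using that assms by (auto simp: filter_empty_conv)
  ultimately show ?thesis
    unfolding subtableau_def by (induction T) (simp_all del: filter_filter)
qed

lemma subtableau_self: "T \<in> SYT n \<Longrightarrow> subtableau T n = T"
proof -
  assume T: "T \<in> SYT n"
  have "map (filter (\<lambda>e. e \<le> n)) T = T"
    using SYT_entry_le[OF T] by (intro map_idI filter_True) blast
  moreover have "filter (\<lambda>R. R \<noteq> []) T = T"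
    using T unfolding SYT_iff by (intro filter_True) blast
  ultimately show ?thesis by (simp add: subtableau_def)
qed

section \<open>Adding a box\<close>

text \<open>For \<open>r = 0\<close>, and no empty row in the tableau, a new row is created.\<close>

fun add_box :: "nat \<Rightarrow> nat \<Rightarrow> tableau \<Rightarrow> tableau" where
  "add_box x r [] = [[x]]"
| "add_box x r (R # T) = (if r < length R then R # add_box x r T else (R @ [x]) # T)"

lemma set_add_box:
  "S \<in> set (add_box x r T) \<Longrightarrow>
    S \<in> set T \<or> (\<exists>R. S = R @ [x] \<and> length R \<le> r \<and> (R = [] \<or> R \<in> set T))"
  by (induction T) (auto split: if_splits)

lemma mset_concat_add_box: "mset (concat (add_box x r T)) = mset (x # concat T)"
  by (induction T) auto

text \<open>All rows passed over are longer than \<open>r\<close>, so the new box at the end of a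
  row of length at most \<open>r\<close> lies above existing boxes, whose entries are smaller than
  \<open>x\<close>. Lengthening a row does not disturb the rows above it.\<close>

lemma sorted_add_box:
  assumes "sorted_wrt row_below T" and "\<And>R e. R \<in> set T \<Longrightarrow> e \<in> set R \<Longrightarrow> e < x"
  shows "sorted_wrt row_below (add_box x r T)"
  using assms
proof (induction T)
  case (Cons R T)
  show ?case
  proof (cases "r < length R")
    case True
    have "row_below R S" if S: "S \<in> set (add_box x r T)" for S
    proof -
      from set_add_box[OF S] consider "S \<in> set T"
        | S' where "S = S' @ [x]" "length S' \<le> r" "S' = [] \<or> S' \<in> set T"
        by blast
      then show ?thesis
      proof cases
        case 1
        then show ?thesis using Cons.prems by simp
      next
        case S': (2 S')
        have below: "row_below R S'"
          using S'(3) Cons.prems by (auto simp: row_below_def)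
        \<comment> \<open>\<open>length S'\<close> is the index of the new box, and \<open>R\<close>
          is long enough to have an entry there.\<close>
        have "R ! length S' < x"
          using True S'(2) Cons.prems(2)[of R] by auto
        with below S' True show ?thesis
          by (auto simp: row_below_def nth_append less_Suc_eq)
      qed
    qed
    moreover have "sorted_wrt row_below (add_box x r T)"
      by (rule Cons.IH) (use Cons.prems in auto)
    ultimately show ?thesis using True by simp
  next
    case False
    have "row_below (R @ [x]) S" if "row_below R S" for S
      using that by (auto simp: row_below_def nth_append)
    with False Cons.prems show ?thesis by simp
  qed
qed simp

lemma add_box_in_SYT:
  assumes T: "T \<in> SYT n"
  shows "add_box (Suc n) r T \<in> SYT (Suc n)"
proof -
  have lt: "\<And>R e. R \<in> set T \<Longrightarrow> e \<in> set R \<Longrightarrow> e < Suc n"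
    using SYT_entry_le[OF T] by fastforce
  let ?T = "add_box (Suc n) r T"
  have "sorted_wrt row_below ?T"
    by (rule sorted_add_box) (use T lt in \<open>auto simp: SYT_iff\<close>)
  moreover have "[] \<notin> set ?T" "\<forall>R \<in> set ?T. sorted_wrt (<) R"
    using T lt by (auto simp: SYT_iff sorted_wrt_append dest!: set_add_box)
  moreover have "distinct (concat ?T)"
    using mset_eq_imp_distinct_iff[OF mset_concat_add_box[of "Suc n" r T]] T lt
    by (auto simp: SYT_iff)
  moreover have "set (concat ?T) = {1..Suc n}"
  proof -
    have "set (concat ?T) = insert (Suc n) (set (concat T))"
      using mset_eq_setD[OF mset_concat_add_box[of "Suc n" r T]] by (simp del: set_concat)
    then show ?thesis using T by (auto simp: SYT_iff simp del: set_concat)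
  qed
  ultimately show ?thesis by (simp add: SYT_iff)
qed

text \<open>Deletion inverts the addition of a box whatever \<open>r\<close> is: only
  \<open>x\<close> goes, and if it formed a row of its own, that row becomes empty and is
  dropped.\<close>

lemma subtableau_add_box:
  assumes "\<And>R e. R \<in> set T \<Longrightarrow> e \<in> set R \<Longrightarrow> e \<le> m" and "[] \<notin> set T" and "m < x"
  shows "subtableau (add_box x r T) m = T"
proof -
  have id: "filter (\<lambda>e. e \<le> m) R = R" if "R \<in> set T" for R
    using that assms(1) by simp
  then have all: "subtableau T' m = T'" if "set T' \<subseteq> set T" for T'
    using that assms(2) by (induction T') (auto simp: subtableau_def)
  \<comment> \<open>Generalised to all lists of rows taken from \<open>T\<close>, so that the
    hypotheses on \<open>T\<close> stay fixed during the induction.\<close>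
  have "set T' \<subseteq> set T \<Longrightarrow> subtableau (add_box x r T') m = T'" for T'
  proof (induction T')
    case Nil
    then show ?case using assms(3) by (simp add: subtableau_def)
  next
    case (Cons R T')
    then show ?case
      using id[of R] all[of T'] assms(2,3) by (auto simp: subtableau_def)
  qed
  then show ?thesis by blast
qed

lemma add_box_append:
  assumes "\<forall>S \<in> set U. r < length S"
  shows "add_box x r (U @ T) = U @ add_box x r T"
  using assms by (induction U) auto

text \<open>The largest entry ends its row. If \<open>R\<close> is the rest of that row, the rows
  below are longer than \<open>R\<close>, so \<open>add_box\<close> with \<open>r = length R\<close>
  passes over exactly these.\<close>

lemma ex_add_box:
  assumes T: "T \<in> SYT (Suc n)"
  shows "\<exists>r \<in> insert 0 (set (shape (subtableau T n))). T = add_box (Suc n) r (subtableau T n)"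
proof -
  have "Suc n \<in> set (concat T)" using T by (simp add: SYT_iff del: set_concat)
  then obtain R' where R': "R' \<in> set T" "Suc n \<in> set R'" by auto
  then obtain U V where UV: "T = U @ R' # V" by (meson split_list)
  from R' obtain R W where R: "R' = R @ Suc n # W" by (meson split_list)
  have "W = []"
  proof (rule ccontr)
    assume "W \<noteq> []"
    then have "hd W \<in> set R'" by (simp add: R)
    moreover have "Suc n < hd W"
      using T \<open>W \<noteq> []\<close> R'(1) R by (auto simp: SYT_iff sorted_wrt_append)
    ultimately show False using SYT_entry_le[OF T R'(1)] by fastforce
  qed
  with R UV have TT: "T = U @ (R @ [Suc n]) # V" by simp
  have le: "e \<le> n" if "e \<in> set (concat U) \<union> set R \<union> set (concat V)" for e
  proof -
    have "e \<in> set (concat T)" "e \<noteq> Suc n"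
      using that T TT by (auto simp: SYT_iff)
    with T show ?thesis by (simp add: SYT_iff le_Suc_eq del: set_concat)
  qed
  have filt: "filter (\<lambda>e. e \<le> n) S = S" if "S \<in> set U \<union> {R} \<union> set V" for S
    using that le by (intro filter_True) auto
  have ne: "[] \<notin> set U" "[] \<notin> set V"
    using T TT by (auto simp: SYT_iff)
  have sub: "subtableau S n = S" if "set S \<subseteq> set U \<union> set V" for S
    using that filt ne by (induction S) (auto simp: subtableau_def)
  have "subtableau T n = subtableau U n @ (if R = [] then [] else [R]) @ subtableau V n"
    using filt[of R] by (simp add: TT subtableau_def)
  then have T_n: "subtableau T n = U @ (if R = [] then [] else [R]) @ V"
    by (simp add: sub)
  \<comment> \<open>The rows in \<open>U\<close> are at least as long as
    \<open>R @ [Suc n]\<close>.\<close>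
  have U: "\<forall>S \<in> set U. length R < length S"
    using T by (auto simp: TT SYT_iff sorted_wrt_append row_below_def)
  show ?thesis
  proof (cases "R = []")
    case True
    \<comment> \<open>A row above the row \<open>[Suc n]\<close> would have to start with an entry
      larger than \<open>Suc n\<close>.\<close>
    have "V = []"
    proof (rule ccontr)
      assume "V \<noteq> []"
      then obtain S where S: "S \<in> set V" by (meson ex_in_conv set_empty)
      then have "row_below [Suc n] S"
        using T True by (auto simp: TT SYT_iff sorted_wrt_append)
      moreover have "S \<noteq> []" using S ne by auto
      ultimately have "Suc n < S ! 0" "S ! 0 \<in> set S"
        by (auto simp: row_below_def)
      then show False using le[of "S ! 0"] S by auto
    qed
    with True TT T_n U add_box_append[OF U, of "Suc n" "[]"] show ?thesis by auto
  next
    case False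
    then show ?thesis
      using TT T_n add_box_append[OF U, of "Suc n" "R # V"]
      by (intro bexI[of _ "length R"]) (auto simp: shape_def)
  qed
qed

section \<open>Columns and weights after adding a box\<close>

text \<open>Row lengths decrease, so if \<open>r\<close> is one of them, the first row of length at
  most \<open>r\<close> has length exactly \<open>r\<close> and the box falls into column
  \<open>r + 1\<close>. Multisets suffice, as only members and sizes of columns are used
  later.\<close>

lemma mset_column_add_box:
  assumes "sorted_wrt (\<ge>) (shape T)" and "[] \<notin> set T" and "r \<in> insert 0 (set (shape T))"
    and "k \<ge> 1"
  shows "mset (column (add_box x r T) k) = (if k = Suc r then {#x#} else {#}) + mset (column T k)"
  using assms
proof (induction T)
  case Nil
  then show ?case by (auto simp: column_def shape_def)
next
  case (Cons R T)
  show ?case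
  proof (cases "r < length R")
    case True
    with Cons.prems have "r \<in> insert 0 (set (shape T))"
      by (auto simp: shape_def)
    with Cons True show ?thesis
      by (auto simp: column_def shape_def)
  next
    case False
    with Cons.prems have "length R = r"
      by (auto simp: shape_def)
    with \<open>k \<ge> 1\<close> False show ?thesis
      by (auto simp: column_def nth_append)
  qed
qed

lemma set_column_subset: "k \<ge> 1 \<Longrightarrow> set (column T k) \<subseteq> set (concat T)"
  by (force simp: column_def)

lemma col_1_eq_length: "[] \<notin> set T \<Longrightarrow> col 1 T = length T"
  by (induction T) (auto simp: col_def column_def Suc_le_eq)

text \<open>Column \<open>r\<close> meets the rows of length at least \<open>r\<close>, and column
  \<open>Suc r\<close> those of length greater than \<open>r\<close>.\<close>

lemma col_eq_col_Suc_plus: "col r T = col (Suc r) T + count_list (shape T) r"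
  by (induction T) (auto simp: col_def column_def shape_def)

lemma
  assumes T: "T \<in> SYT n" and r: "r \<in> insert 0 (set (shape T))"
  shows set_column_add_box: "k \<ge> 1 \<Longrightarrow> set (column (add_box (Suc n) r T) k) =
      (if k = Suc r then {Suc n} else {}) \<union> set (column T k)"
    and col_add_box: "k \<ge> 1 \<Longrightarrow> col k (add_box (Suc n) r T) =
      (if k = Suc r then 1 else 0) + col k T"
    and max_in_column_add_box: "k \<ge> 1 \<Longrightarrow>
      Suc n \<in> set (column (add_box (Suc n) r T) k) \<longleftrightarrow> k = Suc r"
proof -
  assume k: "k \<ge> 1"
  have eq: "mset (column (add_box (Suc n) r T) k) =
      (if k = Suc r then {#Suc n#} else {#}) + mset (column T k)"
    by (rule mset_column_add_box) (use T r k in \<open>auto simp: SYT_def\<close>)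
  show 1: "set (column (add_box (Suc n) r T) k) =
      (if k = Suc r then {Suc n} else {}) \<union> set (column T k)"
    using arg_cong[OF eq, of set_mset] by auto
  show "col k (add_box (Suc n) r T) = (if k = Suc r then 1 else 0) + col k T"
    using arg_cong[OF eq, of size] by (auto simp: col_def)
  have "Suc n \<notin> set (column T k)"
    using set_column_subset[OF k, of T] T by (auto simp: SYT_iff simp del: set_concat)
  with 1 show "Suc n \<in> set (column (add_box (Suc n) r T) k) \<longleftrightarrow> k = Suc r"
    by simp
qed

text \<open>\<open>sigma i\<close> depends only on the column of \<open>i\<close> and on the tableau
  of entries up to \<open>i\<close>; the new box changes neither.\<close>

lemma sigma_add_box_less:
  assumes T: "T \<in> SYT n" and r: "r \<in> insert 0 (set (shape T))" and i: "i \<le> n"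
  shows "sigma i (add_box (Suc n) r T) = sigma i T"
proof -
  have "i \<in> set (column (add_box (Suc n) r T) k) \<longleftrightarrow> i \<in> set (column T k)" if "k \<ge> 1" for k
    using set_column_add_box[OF T r that] i by auto
  moreover have "subtableau (add_box (Suc n) r T) i = subtableau T i"
  proof -
    have "subtableau (add_box (Suc n) r T) n = T"
      by (rule subtableau_add_box) (use T SYT_entry_le[OF T] in \<open>auto simp: SYT_iff\<close>)
    then show ?thesis
      using subtableau_subtableau[OF i, of "add_box (Suc n) r T"] by simp
  qed
  ultimately show ?thesis by (simp add: sigma_def)
qed

text \<open>The new box enlarges column \<open>r + 1\<close> by one, which cancels the
  \<open>+ 1\<close> in \<open>sigma\<close>. What remains for \<open>r > 0\<close> is a difference
  of adjacent column sizes of \<open>T\<close>.\<close>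

lemma sigma_add_box_max:
  assumes T: "T \<in> SYT n" and r: "r \<in> insert 0 (set (shape T))"
  shows "sigma (Suc n) (add_box (Suc n) r T) =
    (if r = 0 then int n + 1 - int (length T) else int (count_list (shape T) r))"
proof -
  let ?T = "add_box (Suc n) r T"
  have self: "subtableau ?T (Suc n) = ?T"
    by (rule subtableau_self[OF add_box_in_SYT[OF T]])
  have mem: "Suc n \<in> set (column ?T k) \<longleftrightarrow> k = Suc r" if "k \<ge> 1" for k
    using max_in_column_add_box[OF T r that] .
  show ?thesis
  proof (cases "r = 0")
    case True
    have "[] \<notin> set T" using T by (simp add: SYT_iff)
    with True mem[of 1] self col_add_box[OF T r, of 1] col_1_eq_length[of T] show ?thesis
      by (simp add: sigma_def)
  next
    case False
    \<comment> \<open>The only column containing \<open>Suc n\<close> is column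
      \<open>r + 1\<close>.\<close>
    have "(THE k. k \<ge> 1 \<and> Suc n \<in> set (column ?T (k + 1))) = r"
      using False mem by (intro the_equality) auto
    moreover have "Suc n \<notin> set (column ?T 1)"
      using False mem[of 1] by simp
    ultimately have "sigma (Suc n) ?T = int (col r ?T) - int (col (r + 1) ?T) + 1"
      by (simp add: sigma_def self)
    also have "\<dots> = int (count_list (shape T) r)"
      using False col_add_box[OF T r, of r] col_add_box[OF T r, of "r + 1"]
        col_eq_col_Suc_plus[of r T]
      by simp
    finally show ?thesis using False by simp
  qed
qed

lemma length_add_box:
  assumes T: "T \<in> SYT n" and r: "r \<in> insert 0 (set (shape T))"
  shows "length (add_box (Suc n) r T) = (if r = 0 then length T + 1 else length T)"
proof -
  have "[] \<notin> set T" "[] \<notin> set (add_box (Suc n) r T)"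
    using T add_box_in_SYT[OF T] by (auto simp: SYT_iff)
  \<comment> \<open>The number of rows is the size of column 1.\<close>
  then show ?thesis
    using col_add_box[OF T r, of 1] by (simp add: col_1_eq_length flip: One_nat_def)
qed

section \<open>The recurrence for the sum over tableaux\<close>

definition tableau_term :: "nat \<Rightarrow> tableau \<Rightarrow> int poly" where
  "tableau_term n T = monom (\<Prod>i = 1..n. sigma i T) (length (shape T))"

lemma tableau_term_add_box:
  assumes T: "T \<in> SYT n" and r: "r \<in> insert 0 (set (shape T))"
  shows "tableau_term (Suc n) (add_box (Suc n) r T) =
    (if r = 0 then monom ((\<Prod>i = 1..n. sigma i T) * (int n + 1 - int (length T))) (length T + 1)
     else monom ((\<Prod>i = 1..n. sigma i T) * int (count_list (shape T) r)) (length T))"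
proof -
  let ?T = "add_box (Suc n) r T"
  have "(\<Prod>i = 1..n. sigma i ?T) = (\<Prod>i = 1..n. sigma i T)"
    by (rule prod.cong) (auto simp: sigma_add_box_less[OF T r])
  then have "(\<Prod>i = 1..Suc n. sigma i ?T) = (\<Prod>i = 1..n. sigma i T) * sigma (Suc n) ?T"
    by simp
  then show ?thesis
    unfolding tableau_term_def sigma_add_box_max[OF T r]
    using length_add_box[OF T r] by (simp add: shape_def)
qed

lemma sum_tableau_term_add_box:
  assumes T: "T \<in> SYT n"
  shows "(\<Sum>r\<in>insert 0 (set (shape T)). tableau_term (Suc n) (add_box (Suc n) r T)) =
    eulerian_step n (tableau_term n T)"
proof -
  let ?P = "\<Prod>i = 1..n. sigma i T" and ?l = "length T"
  \<comment> \<open>Rows are nonempty, so the choice \<open>r = 0\<close> of a new row is distinct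
    from all others.\<close>
  have 0: "0 \<notin> set (shape T)" using T by (auto simp: SYT_iff shape_def)
  have "(\<Sum>r\<in>insert 0 (set (shape T)). tableau_term (Suc n) (add_box (Suc n) r T)) =
      monom (?P * (int n + 1 - int ?l)) (?l + 1) +
      (\<Sum>r\<in>set (shape T). monom (?P * int (count_list (shape T) r)) ?l)"
    using 0 by (subst sum.insert) (auto simp: tableau_term_add_box[OF T] intro!: sum.cong)
  also have "(\<Sum>r\<in>set (shape T). monom (?P * int (count_list (shape T) r)) ?l) =
      monom (?P * int (\<Sum>r\<in>set (shape T). count_list (shape T) r)) ?l"
    by (simp add: sum_distrib_left monom_sum)
  \<comment> \<open>The multiplicities of the row lengths add up to the number of rows.\<close>
  also have "(\<Sum>r\<in>set (shape T). count_list (shape T) r) = ?l"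
    by (subst sum_count_set) (auto simp: shape_def)
  finally show ?thesis
    by (simp add: tableau_term_def eulerian_step_monom shape_def)
qed

text \<open>Deleting \<open>n + 1\<close> gives back \<open>T\<close>, and the column that contained
  it gives back \<open>r\<close>.\<close>

lemma bij_betw_add_box:
  "bij_betw (\<lambda>(T, r). add_box (Suc n) r T) (SIGMA T:SYT n. insert 0 (set (shape T))) (SYT (Suc n))"
proof (rule bij_betw_imageI)
  have sub: "subtableau (add_box (Suc n) r T) n = T" if "T \<in> SYT n" for T r
    by (rule subtableau_add_box) (use that SYT_entry_le[OF that] in \<open>auto simp: SYT_iff\<close>)
  show "inj_on (\<lambda>(T, r). add_box (Suc n) r T) (SIGMA T:SYT n. insert 0 (set (shape T)))"
  proof (rule inj_onI, clarify)
    fix T r T' r'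
    assume T: "T \<in> SYT n" and r: "r \<in> insert 0 (set (shape T))"
      and T': "T' \<in> SYT n" and r': "r' \<in> insert 0 (set (shape T'))"
      and eq: "add_box (Suc n) r T = add_box (Suc n) r' T'"
    have "T = T'" using sub[OF T, of r] sub[OF T', of r'] eq by simp
    moreover have "r = r'"
      using max_in_column_add_box[OF T r, of "Suc r"] max_in_column_add_box[OF T' r', of "Suc r"] eq
      by simp
    ultimately show "T = T' \<and> r = r'" by simp
  qed
  show "(\<lambda>(T, r). add_box (Suc n) r T) ` (SIGMA T:SYT n. insert 0 (set (shape T))) = SYT (Suc n)"
    (is "?f ` ?A = _")
  proof
    show "?f ` ?A \<subseteq> SYT (Suc n)" using add_box_in_SYT by auto
    show "SYT (Suc n) \<subseteq> ?f ` ?A"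
    proof
      fix T assume T: "T \<in> SYT (Suc n)"
      then obtain r where "r \<in> insert 0 (set (shape (subtableau T n)))"
          "T = add_box (Suc n) r (subtableau T n)"
        using ex_add_box by blast
      moreover have "subtableau T n \<in> SYT n"
        using subtableau_in_SYT[OF T] by simp
      ultimately show "T \<in> ?f ` ?A"
        by (intro image_eqI[of _ _ "(subtableau T n, r)"]) auto
    qed
  qed
qed

lemma sum_tableau_term_Suc:
  "(\<Sum>T\<in>SYT (Suc n). tableau_term (Suc n) T) = eulerian_step n (\<Sum>T\<in>SYT n. tableau_term n T)"
proof -
  have "(\<Sum>T\<in>SYT (Suc n). tableau_term (Suc n) T) =
      (\<Sum>(T, r)\<in>(SIGMA T:SYT n. insert 0 (set (shape T))). tableau_term (Suc n) (add_box (Suc n) r T))"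
    by (subst sum.reindex_bij_betw[OF bij_betw_add_box, symmetric]) (simp add: case_prod_unfold)
  also have "\<dots> =
      (\<Sum>T\<in>SYT n. \<Sum>r\<in>insert 0 (set (shape T)). tableau_term (Suc n) (add_box (Suc n) r T))"
    by (subst sum.Sigma) (auto simp: finite_SYT)
  also have "\<dots> = (\<Sum>T\<in>SYT n. eulerian_step n (tableau_term n T))"
    by (rule sum.cong) (simp_all only: sum_tableau_term_add_box)
  finally show ?thesis by (simp add: eulerian_step_sum)
qed

theorem theorem4p6:
  fixes n :: nat
  assumes "n \<ge> 1"
  shows "eulerian_poly n =
    (\<Sum>T \<in> SYT n. monom (\<Prod>i = 1..n. sigma i T) (length (shape T)))"
proof -
  have "eulerian_poly n = (\<Sum>T\<in>SYT n. tableau_term n T)"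
  proof (induction n)
    \<comment> \<open>The only permutation has no descents and the only tableau has no rows, so both
      sides are the constant 1.\<close>
    case 0
    show ?case
      by (simp add: eulerian_poly_def des_def SYT_0 tableau_term_def shape_def)
  next
    case (Suc n)
    then show ?case
      by (simp add: eulerian_poly_Suc sum_tableau_term_Suc)
  qed
  then show ?thesis by (simp add: tableau_term_def)
qed

end
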